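(* Let $\sigma\subset\mathbb{Z}^2$ be a finite set whose convex hull $I_\sigma$ is a lattice polygon, let $d\ge 1$ be an integer, and let $$\mathcal{P}(u,v)=\sum_{\gamma\in\sigma^d}\beta^{d}_{\gamma}(u,v)\,(\omega_\gamma p_\gamma,\omega_\gamma),\qquad (u,v)\in I^d,$$ be a toric Bézier patch of depth $d$, where $\sigma^d$ is the $d$-fold Minkowski sum of $\sigma$, $I^d$ is the convex hull of $\sigma^d$, $\beta^d_\gamma$ are the toric Bernstein basis functions of depth $d$, and $(\omega_\gamma p_\gamma,\omega_\gamma)\in\mathbb{R}^4$ are the mass-points. Suppose the mass-points associated to the boundary lattice points of $I^d$ are given. For $\gamma\in\sigma^d$ put $$\xi^{\gamma,u}=\sum_{\sigma_i\in\sigma}\frac{\partial^{2}\beta_{\sigma_i}(u,v)}{\partial u^2}\,\beta^{d-1}_{\gamma-\sigma_i}(u,v),\qquad \eta^{\gamma,u}=\sum_{\sigma_i\in\sigma}\frac{\partial\beta_{\sigma_i}(u,v)}{\partial u}\left(\sum_{\delta_i\in\sigma,\ \delta_i\neq\sigma_i}\frac{\partial\beta_{\delta_i}(u,v)}{\partial u}\,\beta^{d-2}_{\gamma-\sigma_i-\delta_i}(u,v)\right),$$ and let $\xi^{\gamma,v},\eta^{\gamma,v}$ be given by the same formulas with $\partial/\partial u$ replaced by $\partial/\partial v$; the coefficients $\xi^{\lambda,u},\xi^{\lambda,v},\eta^{\lambda,u},\eta^{\lambda,v}$ are obtained by replacing $\gamma$ by $\lambda$. Then $\mathcal{P}$ is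 a quasi-harmonic toric Bézier surface if and only if its inner unknown mass-points $(\omega_\lambda p_\lambda,\omega_\lambda)$ satisfy the following system of linear equations, one (vector) equation in $\mathbb{R}^4$ for each inner lattice point $\lambda\in\sigma^d$ of $I^d$: $$\int_{I^d}\sum_{\gamma\in\sigma^d}\Big((\xi^{\lambda,u}+(d-1)\eta^{\lambda,u})+(\xi^{\lambda,v}+(d-1)\eta^{\lambda,v})\Big)\Big((\xi^{\gamma,u}+(d-1)\eta^{\gamma,u})+(\xi^{\gamma,v}+(d-1)\eta^{\gamma,v})\Big)(\omega_\gamma p_\gamma,\omega_\gamma)\,du\,dv=0 .$$
   Context: **Bernstein polynomials of a lattice polygon.** Let $\sigma\subset\mathbb{Z}^2$ be finite with convex hull the lattice polygon $I_\sigma$, with corner points $v_1,\dots,v_n$ and $n$ edges. For each $k=1,\dots,n$ let $\overline{L}_k(u,v)=\alpha_k u+\beta_k v+\gamma_k$ be the affine function vanishing on the $k$-th edge of $I_\sigma$, normalized so that $(\alpha_k,\beta_k)$ points into $I_\sigma$ and is the shortest normal vector with integer coordinates in that direction. For $\sigma_i\in\sigma$ the Bernstein polynomial is $$\beta_{\sigma_i}(u,v)=c_{\sigma_i}\prod_{k=1}^n\overline{L}_k(u,v)^{\overline{L}_k(\sigma_i)},$$ where the $c_{\sigma_i}>0$ are arbitrary fixed normalizing constants. **Depth $d$.** The Minkowski sum is $A\oplus B=\{a+b: a\in A,\ b\in B\}$, and $\sigma^d=\sigma\oplus\cdots\oplus\sigma$ ($d$ summands). $I^d$ denotes the convex hull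 of $\sigma^d$. The discrete convolution of arrays $P=\{P_a\}_{a\in A}$, $Q=\{Q_b\}_{b\in B}$ is the array indexed by $A\oplus B$ with entries $(P\otimes Q)_c=\sum_{a+b=c}P_aQ_b$. The toric Bernstein basis functions of depth $d$, $\{\beta^d_\gamma(u,v)\}_{\gamma\in\sigma^d}$, are the $d$-fold convolution of $\{\beta_{\sigma_i}(u,v)\}_{\sigma_i\in\sigma}$ with itself. Conventions: $\beta^k_\mu=0$ if $\mu\notin\sigma^k$; $\sigma^0=\{(0,0)\}$ and $\beta^0_{(0,0)}=1$; for $d=1$ the terms with factor $d-1$ are $0$. **Toric Bézier patch of depth $d$.** A map $\mathcal{P}(u,v)=\sum_{\gamma\in\sigma^d}\beta^d_\gamma(u,v)(\omega_\gamma p_\gamma,\omega_\gamma)$ on $I^d$, where $p_\gamma$ are control points in space and $\omega_\gamma\ge 0$ are weights. The mass-points $(\omega_\gamma p_\gamma,\omega_\gamma)$ are four-dimensional, and derivatives of $\mathcal{P}$ are taken in the space of mass-points (not of the quotient rational surface). The second order partial derivatives of $\mathcal{P}$ are taken to be given by $$\mathcal{P}_{uu}=d\sum_{\gamma\in\sigma^d}\xi^{\gamma,u}(\omega_\gamma p_\gamma,\omega_\gamma)+d(d-1)\sum_{\gamma\in\sigma^d}\eta^{\gamma,u}(\omega_\gamma p_\gamma,\omega_\gamma),$$ $$\mathcal{P}_{vv}=d\sum_{\gamma\in\sigma^d}\xi^{\gamma,v}(\omega_\gamma p_\gamma,\omega_\gamma)+d(d-1)\sum_{\gamma\in\sigma^d}\eta^{\gamma,v}(\omega_\gamma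 p_\gamma,\omega_\gamma),$$ with the coefficients $\xi,\eta$ defined in the claim (in particular with the inner sums in $\eta$ restricted to $\delta_i\neq\sigma_i$). **Quasi-harmonic functional and quasi-harmonic patch.** The quasi-harmonic functional is $$\mathcal{H}(\mathcal{P})=\int_{I^d}\big(\mathcal{P}_{uu}(u,v)+\mathcal{P}_{vv}(u,v)\big)^2\,du\,dv,$$ where $\mathcal{P}_{uu},\mathcal{P}_{vv}$ are given by the formulas above and the square is the inner product of the $\mathbb{R}^4$-valued integrand with itself. With the boundary mass-points fixed, $\mathcal{P}$ is called a quasi-harmonic toric Bézier patch (surface) if it extremizes (minimizes) $\mathcal{H}$ as a function of the inner mass-points, i.e. the gradient of $\mathcal{H}$ with respect to the four coordinates of every inner mass-point vanishes. *)

theory Defs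
  imports "HOL-Analysis.Analysis"
begin

definition pt :: "int \<times> int \<Rightarrow> real \<times> real" where
  "pt a = (of_int (fst a), of_int (snd a))"

definition lattice_hull :: "(int \<times> int) set \<Rightarrow> (real \<times> real) set" where
  "lattice_hull S = convex hull (pt ` S)"

definition inward_normal ::
    "(real \<times> real) set \<Rightarrow> (real \<times> real) set \<Rightarrow> int \<times> int \<Rightarrow> bool" where
  "inward_normal I e n \<longleftrightarrow>
     n \<noteq> (0, 0) \<and> (\<forall>p\<in>e. \<forall>q\<in>e. pt n \<bullet> (q - p) = 0) \<and> (\<forall>p\<in>e. \<forall>q\<in>I. pt n \<bullet> (q - p) \<ge> 0)"

definition edge_normal :: "(real \<times> real) set \<Rightarrow> (real \<times> real) set \<Rightarrow> int \<times> int" where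
  "edge_normal I e = arg_min (\<lambda>n. norm (pt n)) (inward_normal I e)"

definition edge_offset :: "(real \<times> real) set \<Rightarrow> (real \<times> real) set \<Rightarrow> real" where
  "edge_offset I e = (THE g. \<forall>p\<in>e. pt (edge_normal I e) \<bullet> p + g = 0)"

definition edge_fun :: "(real \<times> real) set \<Rightarrow> (real \<times> real) set \<Rightarrow> real \<times> real \<Rightarrow> real" where
  "edge_fun I e x = pt (edge_normal I e) \<bullet> x + edge_offset I e"

text \<open>The edges of a lattice polygon pass through lattice points, so the exponents below are
  values of \<open>edge_fun\<close> that are already natural numbers; \<open>nat\<close> and the floor only convert the type.
  Natural powers are essential: off the polygon the bases can be negative.\<close>

definition bern ::
    "(int \<times> int) set \<Rightarrow> (int \<times> int \<Rightarrow> real) \<Rightarrow> int \<times> int \<Rightarrow> real \<times> real \<Rightarrow> real" where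
  "bern \<sigma> c s x = c s * (\<Prod>e | e edge_of lattice_hull \<sigma>.
     edge_fun (lattice_hull \<sigma>) e x ^ nat \<lfloor>edge_fun (lattice_hull \<sigma>) e (pt s)\<rfloor>)"

primrec minkowski_power :: "(int \<times> int) set \<Rightarrow> nat \<Rightarrow> (int \<times> int) set" where
  "minkowski_power \<sigma> 0 = {(0, 0)}"
| "minkowski_power \<sigma> (Suc k) = \<sigma> + minkowski_power \<sigma> k"

definition convolution ::
    "(int \<times> int) set \<Rightarrow> (int \<times> int \<Rightarrow> real) \<Rightarrow> (int \<times> int) set \<Rightarrow> (int \<times> int \<Rightarrow> real)
      \<Rightarrow> int \<times> int \<Rightarrow> real" where
  "convolution A P B Q g = (\<Sum>(a, b) \<in> {(a, b). a \<in> A \<and> b \<in> B \<and> a + b = g}. P a * Q b)"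

text \<open>Basis functions of depth \<open>k\<close>; they vanish at indices outside \<open>minkowski_power \<sigma> k\<close>,
  where the convolution is an empty sum.\<close>

primrec toric_bern ::
    "(int \<times> int) set \<Rightarrow> (int \<times> int \<Rightarrow> real) \<Rightarrow> nat \<Rightarrow> int \<times> int \<Rightarrow> real \<times> real \<Rightarrow> real" where
  "toric_bern \<sigma> c 0 = (\<lambda>g x. if g = (0, 0) then 1 else 0)"
| "toric_bern \<sigma> c (Suc k) = (\<lambda>g x.
     convolution \<sigma> (\<lambda>s. bern \<sigma> c s x) (minkowski_power \<sigma> k) (\<lambda>m. toric_bern \<sigma> c k m x) g)"

definition partial_u :: "(real \<times> real \<Rightarrow> real) \<Rightarrow> real \<times> real \<Rightarrow> real" where
  "partial_u f x = deriv (\<lambda>t. f (t, snd x)) (fst x)"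

definition partial_v :: "(real \<times> real \<Rightarrow> real) \<Rightarrow> real \<times> real \<Rightarrow> real" where
  "partial_v f x = deriv (\<lambda>t. f (fst x, t)) (snd x)"

text \<open>In \<open>xi\<close>, \<open>eta\<close> and \<open>patch_second\<close> the operator \<open>D\<close> is \<open>partial_u\<close> or \<open>partial_v\<close>.
  For \<open>d = 1\<close> the truncated index \<open>d - 2\<close> in \<open>eta\<close> is harmless, since \<open>eta\<close> is only used
  with the factor \<open>d - 1\<close>.\<close>

definition xi ::
    "((real \<times> real \<Rightarrow> real) \<Rightarrow> real \<times> real \<Rightarrow> real) \<Rightarrow> (int \<times> int) set \<Rightarrow> (int \<times> int \<Rightarrow> real)
      \<Rightarrow> nat \<Rightarrow> int \<times> int \<Rightarrow> real \<times> real \<Rightarrow> real" where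
  "xi D \<sigma> c d g x = (\<Sum>s\<in>\<sigma>. D (D (bern \<sigma> c s)) x * toric_bern \<sigma> c (d - 1) (g - s) x)"

definition eta ::
    "((real \<times> real \<Rightarrow> real) \<Rightarrow> real \<times> real \<Rightarrow> real) \<Rightarrow> (int \<times> int) set \<Rightarrow> (int \<times> int \<Rightarrow> real)
      \<Rightarrow> nat \<Rightarrow> int \<times> int \<Rightarrow> real \<times> real \<Rightarrow> real" where
  "eta D \<sigma> c d g x = (\<Sum>s\<in>\<sigma>. D (bern \<sigma> c s) x *
     (\<Sum>t\<in>\<sigma> - {s}. D (bern \<sigma> c t) x * toric_bern \<sigma> c (d - 2) (g - s - t) x))"

text \<open>Mass-points \<open>(\<omega> p, \<omega>)\<close> are elements of \<open>(real ^ 3) \<times> real\<close>, a Euclidean space of dimension 4.\<close>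

definition mass_point ::
    "(int \<times> int \<Rightarrow> real) \<Rightarrow> (int \<times> int \<Rightarrow> real ^ 3) \<Rightarrow> int \<times> int \<Rightarrow> (real ^ 3) \<times> real" where
  "mass_point \<omega> p g = (\<omega> g *\<^sub>R p g, \<omega> g)"

definition toric_patch ::
    "(int \<times> int) set \<Rightarrow> (int \<times> int \<Rightarrow> real) \<Rightarrow> nat \<Rightarrow> (int \<times> int \<Rightarrow> (real ^ 3) \<times> real)
      \<Rightarrow> real \<times> real \<Rightarrow> (real ^ 3) \<times> real" where
  "toric_patch \<sigma> c d M x = (\<Sum>g\<in>minkowski_power \<sigma> d. toric_bern \<sigma> c d g x *\<^sub>R M g)"

text \<open>The second order derivatives of \<open>toric_patch\<close> that enter the functional are given by an
  explicit formula and not by differentiating \<open>toric_patch\<close>; the two differ in general, because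
  \<open>eta\<close> leaves out the terms with \<open>t = s\<close>.\<close>

definition patch_second ::
    "((real \<times> real \<Rightarrow> real) \<Rightarrow> real \<times> real \<Rightarrow> real) \<Rightarrow> (int \<times> int) set \<Rightarrow> (int \<times> int \<Rightarrow> real)
      \<Rightarrow> nat \<Rightarrow> (int \<times> int \<Rightarrow> (real ^ 3) \<times> real) \<Rightarrow> real \<times> real \<Rightarrow> (real ^ 3) \<times> real" where
  "patch_second D \<sigma> c d M x =
     real d *\<^sub>R (\<Sum>g\<in>minkowski_power \<sigma> d. xi D \<sigma> c d g x *\<^sub>R M g) +
     (real d * (real d - 1)) *\<^sub>R (\<Sum>g\<in>minkowski_power \<sigma> d. eta D \<sigma> c d g x *\<^sub>R M g)"

definition quasi_harmonic_functional ::
    "(int \<times> int) set \<Rightarrow> (int \<times> int \<Rightarrow> real) \<Rightarrow> nat \<Rightarrow> (int \<times> int \<Rightarrow> (real ^ 3) \<times> real) \<Rightarrow> real" where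
  "quasi_harmonic_functional \<sigma> c d M = integral (lattice_hull (minkowski_power \<sigma> d))
     (\<lambda>x. (patch_second partial_u \<sigma> c d M x + patch_second partial_v \<sigma> c d M x) \<bullet>
          (patch_second partial_u \<sigma> c d M x + patch_second partial_v \<sigma> c d M x))"

definition inner_points :: "(int \<times> int) set \<Rightarrow> nat \<Rightarrow> (int \<times> int) set" where
  "inner_points \<sigma> d =
     {l \<in> minkowski_power \<sigma> d. pt l \<in> interior (lattice_hull (minkowski_power \<sigma> d))}"

text \<open>Extremality with fixed boundary: the gradient of the functional with respect to the four
  coordinates of each inner mass-point, all others being held fixed, is zero. The coordinates of a
  mass-point vary freely in the 4-dimensional space.\<close>

definition quasi_harmonic ::
    "(int \<times> int) set \<Rightarrow> (int \<times> int \<Rightarrow> real) \<Rightarrow> nat \<Rightarrow> (int \<times> int \<Rightarrow> (real ^ 3) \<times> real) \<Rightarrow> bool" where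
  "quasi_harmonic \<sigma> c d M \<longleftrightarrow>
     (\<forall>l\<in>inner_points \<sigma> d. GDERIV (\<lambda>m. quasi_harmonic_functional \<sigma> c d (M(l := m))) (M l) :> 0)"

end

theory Submission
  imports Defs
begin

text \<open>
  Put \<open>h\<^sub>g = (\<xi>\<^sup>g\<^sup>,\<^sup>u + (d - 1) \<eta>\<^sup>g\<^sup>,\<^sup>u) + (\<xi>\<^sup>g\<^sup>,\<^sup>v + (d - 1) \<eta>\<^sup>g\<^sup>,\<^sup>v)\<close>. The functional is
  \<open>d\<^sup>2\<close> times the integral of \<open>|\<Sum>g. h\<^sub>g M\<^sub>g|\<^sup>2\<close>. The \<open>h\<^sub>g\<close> are polynomials and the domain is
  compact, so all integrals exist and the functional is a quadratic function of each single
  mass-point \<open>M\<^sub>l\<close>. Its gradient there is \<open>2 d\<^sup>2\<close> times the integral of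
  \<open>h\<^sub>l (\<Sum>g. h\<^sub>g M\<^sub>g)\<close>, and \<open>d \<noteq> 0\<close>.
\<close>

text \<open>Induction on the polynomial, with the sum and product rules. The direction
  \<open>v\<close> is fixed in the second conjunct because a partial derivative is the value of
  \<open>f' x\<close> at a basis vector.\<close>

lemma real_polynomial_function_has_derivative:
  fixes f :: "'a::real_normed_vector \<Rightarrow> real"
  assumes "real_polynomial_function f"
  shows "\<exists>f'. (\<forall>x. (f has_derivative f' x) (at x)) \<and>
              (\<forall>v. real_polynomial_function (\<lambda>x. f' x v))"
  using assms
proof (induction rule: real_polynomial_function.induct)
  case (linear f)
  then show ?case
    by (intro exI[of _ "\<lambda>x. f"])
      (simp add: bounded_linear_imp_has_derivative real_polynomial_function.intros(2))
next
  case (const c)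
  then show ?case
    by (intro exI[of _ "\<lambda>x v. 0"]) (simp add: real_polynomial_function.intros(2))
next
  case (add f g)
  then obtain f' g' where
    "\<forall>x. (f has_derivative f' x) (at x)" "\<forall>v. real_polynomial_function (\<lambda>x. f' x v)"
    "\<forall>x. (g has_derivative g' x) (at x)" "\<forall>v. real_polynomial_function (\<lambda>x. g' x v)"
    by metis
  then show ?case
    by (intro exI[of _ "\<lambda>x v. f' x v + g' x v"])
      (simp add: has_derivative_add real_polynomial_function.intros(3))
next
  case (mult f g)
  then obtain f' g' where
    "\<forall>x. (f has_derivative f' x) (at x)" "\<forall>v. real_polynomial_function (\<lambda>x. f' x v)"
    "\<forall>x. (g has_derivative g' x) (at x)" "\<forall>v. real_polynomial_function (\<lambda>x. g' x v)"
    by metis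
  with mult show ?case
    by (intro exI[of _ "\<lambda>x v. f x * g' x v + f' x v * g x"])
      (simp add: has_derivative_mult real_polynomial_function.intros(3,4))
qed

text \<open>\<open>partial_u f x\<close> is the total derivative at \<open>x\<close> in the
  direction \<open>(1, 0)\<close>. Since the result is again a polynomial, the operator can be
  applied twice, as in \<open>xi\<close>.\<close>

lemma real_polynomial_function_partial_u:
  assumes "real_polynomial_function f"
  shows "real_polynomial_function (partial_u f)"
proof -
  obtain f' where f': "\<And>x. (f has_derivative f' x) (at x)"
    and poly: "\<And>v. real_polynomial_function (\<lambda>x. f' x v)"
    using real_polynomial_function_has_derivative[OF assms] by metis
  have partial: "partial_u f = (\<lambda>x. f' x (1, 0))"
  proof
    fix x
    have lin: "linear (f' x)"
      using f' by (rule has_derivative_linear)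
    have "((\<lambda>t. f (t, snd x)) has_derivative (\<lambda>t. f' x (t, 0))) (at (fst x))"
      by (rule has_derivative_compose[where f = "\<lambda>t. (t, snd x)" and g = f,
            OF has_derivative_Pair[OF has_derivative_ident has_derivative_const]])
        (simp add: f')
    \<comment> \<open>Linearity gives the derivative the form of multiplication by a constant, which
      a field derivative requires; \<open>scaleR_Pair\<close> would undo the rewriting.\<close>
    also have "(\<lambda>t. f' x (t, 0)) = (\<lambda>t. f' x (t *\<^sub>R (1, 0)))"
      by simp
    also have "\<dots> = (*) (f' x (1, 0))"
      by (rule ext) (simp add: linear_scale[OF lin] mult.commute del: scaleR_Pair)
    finally show "partial_u f x = f' x (1, 0)"
      unfolding partial_u_def has_field_derivative_def[symmetric] by (rule DERIV_imp_deriv)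
  qed
  show ?thesis
    unfolding partial by (rule poly)
qed

lemma real_polynomial_function_partial_v:
  assumes "real_polynomial_function f"
  shows "real_polynomial_function (partial_v f)"
proof -
  obtain f' where f': "\<And>x. (f has_derivative f' x) (at x)"
    and poly: "\<And>v. real_polynomial_function (\<lambda>x. f' x v)"
    using real_polynomial_function_has_derivative[OF assms] by metis
  have partial: "partial_v f = (\<lambda>x. f' x (0, 1))"
  proof
    fix x
    have lin: "linear (f' x)"
      using f' by (rule has_derivative_linear)
    have "((\<lambda>t. f (fst x, t)) has_derivative (\<lambda>t. f' x (0, t))) (at (snd x))"
      by (rule has_derivative_compose[where f = "\<lambda>t. (fst x, t)" and g = f,
            OF has_derivative_Pair[OF has_derivative_const has_derivative_ident]])
        (simp add: f')
    also have "(\<lambda>t. f' x (0, t)) = (\<lambda>t. f' x (t *\<^sub>R (0, 1)))"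
      by simp
    also have "\<dots> = (*) (f' x (0, 1))"
      by (rule ext) (simp add: linear_scale[OF lin] mult.commute del: scaleR_Pair)
    finally show "partial_v f x = f' x (0, 1)"
      unfolding partial_v_def has_field_derivative_def[symmetric] by (rule DERIV_imp_deriv)
  qed
  show ?thesis
    unfolding partial by (rule poly)
qed

lemma real_polynomial_function_edge_fun: "real_polynomial_function (edge_fun I e)"
  unfolding edge_fun_def
  by (rule real_polynomial_function.intros(3)[OF real_polynomial_function.intros(1,2)])
    (rule bounded_linear_inner_right)

lemma real_polynomial_function_bern: "real_polynomial_function (bern \<sigma> c s)"
proof -
  have "real_polynomial_function (\<lambda>x. \<Prod>e\<in>E. edge_fun I e x ^ n e)" for E I n
  proof (cases "finite E")
    case True
    then show ?thesis
      by (intro real_polynomial_function_prod real_polynomial_function_power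
          real_polynomial_function_edge_fun)
  next
    \<comment> \<open>A product over an infinite index set is 1 by convention, hence
      constant.\<close>
    case False
    then show ?thesis
      by (simp add: real_polynomial_function.intros(2))
  qed
  then show ?thesis
    unfolding bern_def
    by (intro real_polynomial_function.intros(2,4))
qed

lemma finite_minkowski_power: "finite \<sigma> \<Longrightarrow> finite (minkowski_power \<sigma> k)"
  by (induction k) (auto intro: finite_set_plus)

lemma real_polynomial_function_toric_bern:
  assumes "finite \<sigma>"
  shows "real_polynomial_function (toric_bern \<sigma> c k g)"
proof (induction k arbitrary: g)
  case 0
  then show ?case by (simp add: real_polynomial_function.intros(2))
next
  case (Suc k)
  have "finite {(a, b). a \<in> \<sigma> \<and> b \<in> minkowski_power \<sigma> k \<and> a + b = g}"
    by (rule finite_subset[of _ "\<sigma> \<times> minkowski_power \<sigma> k"])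
      (auto simp: assms finite_minkowski_power)
  then show ?case
    unfolding toric_bern.simps convolution_def case_prod_unfold
    by (intro real_polynomial_function_sum real_polynomial_function.intros(4)
        real_polynomial_function_bern Suc)
qed

text \<open>Keeping \<open>D\<close> abstract treats both partial derivatives at once.\<close>

lemma
  assumes "finite \<sigma>"
    and D: "\<And>f. real_polynomial_function f \<Longrightarrow> real_polynomial_function (D f)"
  shows real_polynomial_function_xi: "real_polynomial_function (xi D \<sigma> c d g)"
    and real_polynomial_function_eta: "real_polynomial_function (eta D \<sigma> c d g)"
  unfolding xi_def eta_def
  by (intro real_polynomial_function_sum real_polynomial_function.intros(4) D finite_Diff assms(1)
      real_polynomial_function_bern real_polynomial_function_toric_bern)+

text \<open>Lebesgue integrability on the compact set implies gauge integrability.\<close>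

lemma integrable_continuous_compact:
  fixes f :: "'a::euclidean_space \<Rightarrow> 'b::euclidean_space"
  assumes "compact S" "continuous_on S f"
  shows "f integrable_on S"
  using borel_integrable_compact[OF assms]
  by (intro set_borel_integral_eq_integral) (simp add: set_integrable_def)

text \<open>With every other \<open>M g\<close> fixed, the integral is a quadratic polynomial in
  \<open>m\<close>, and its gradient can be read off from its coefficients.\<close>

lemma GDERIV_integral_norm_square:
  fixes h :: "'i \<Rightarrow> 'a::euclidean_space \<Rightarrow> real" and M :: "'i \<Rightarrow> 'b::euclidean_space"
  assumes "finite G" "l \<in> G" "compact K" and h: "\<And>g. g \<in> G \<Longrightarrow> continuous_on K (h g)"
  shows "GDERIV (\<lambda>m. integral K (\<lambda>x. (\<Sum>g\<in>G. h g x *\<^sub>R (M(l := m)) g) \<bullet>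
                                       (\<Sum>g\<in>G. h g x *\<^sub>R (M(l := m)) g))) (M l)
          :> 2 *\<^sub>R integral K (\<lambda>x. \<Sum>g\<in>G. (h l x * h g x) *\<^sub>R M g)"
proof -
  \<comment> \<open>\<open>R\<close> collects the terms that do not change with \<open>m\<close>;
    \<open>a\<close>, \<open>b\<close> and \<open>r\<close> are the coefficients of the quadratic
    polynomial, \<open>b\<close> being a vector.\<close>
  define R where "R x = (\<Sum>g\<in>G - {l}. h g x *\<^sub>R M g)" for x
  define a where "a = integral K (\<lambda>x. h l x * h l x)"
  define b where "b = integral K (\<lambda>x. h l x *\<^sub>R R x)"
  define r where "r = integral K (\<lambda>x. R x \<bullet> R x)"
  have sum_upd: "(\<Sum>g\<in>G. h g x *\<^sub>R (M(l := m)) g) = h l x *\<^sub>R m + R x" for x m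
    using assms(1,2) by (simp add: R_def sum.remove)
  have hl: "continuous_on K (h l)" and R: "continuous_on K R"
    unfolding R_def using assms by (auto intro!: continuous_intros)
  have ia: "(\<lambda>x. h l x * h l x) integrable_on K" and ib: "(\<lambda>x. h l x *\<^sub>R R x) integrable_on K"
    and ir: "(\<lambda>x. R x \<bullet> R x) integrable_on K"
    using \<open>compact K\<close> hl R by (auto intro!: integrable_continuous_compact continuous_intros)
  have quadratic: "integral K (\<lambda>x. (h l x *\<^sub>R m + R x) \<bullet> (h l x *\<^sub>R m + R x))
      = a * (m \<bullet> m) + 2 * (b \<bullet> m) + r" for m
  proof -
    \<comment> \<open>In the mixed term, the inner product with \<open>m\<close> is a bounded linear
      map and so commutes with the integral that defines \<open>b\<close>.\<close>
    have "((\<lambda>x. h l x * h l x * (m \<bullet> m) + 2 * ((h l x *\<^sub>R R x) \<bullet> m) + R x \<bullet> R x)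
        has_integral a * (m \<bullet> m) + 2 * (b \<bullet> m) + r) K"
      unfolding a_def b_def r_def
      using has_integral_linear[OF integrable_integral[OF ib] bounded_linear_inner_left, of m]
      by (intro has_integral_add has_integral_mult_left has_integral_mult_right
          integrable_integral ia ir) (simp add: o_def)
    then show ?thesis
      by (intro integral_unique)
        (simp add: inner_add_left inner_add_right inner_commute algebra_simps)
  qed
  \<comment> \<open>Splitting off the term \<open>g = l\<close> gives
    \<open>a *\<^sub>R M l + b\<close>, half the gradient of the quadratic polynomial at
    \<open>M l\<close>.\<close>
  have "integral K (\<lambda>x. \<Sum>g\<in>G. (h l x * h g x) *\<^sub>R M g)
      = integral K (\<lambda>x. (h l x * h l x) *\<^sub>R M l + h l x *\<^sub>R R x)"
    using assms(1,2) by (simp add: R_def sum.remove scaleR_sum_right)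
  also have "\<dots> = a *\<^sub>R M l + b"
    unfolding a_def b_def
    using has_integral_linear[OF integrable_integral[OF ia] bounded_linear_scaleR_left, of "M l"]
    by (intro integral_unique has_integral_add integrable_integral ib) (simp add: o_def)
  finally have grad: "integral K (\<lambda>x. \<Sum>g\<in>G. (h l x * h g x) *\<^sub>R M g) = a *\<^sub>R M l + b" .
  show ?thesis
    unfolding sum_upd quadratic grad gderiv_def
    by (auto intro!: derivative_eq_intros simp: inner_add_right inner_commute algebra_simps)
qed

text \<open>The derivative is unique, and a vector is determined by its inner products with all
  vectors.\<close>

lemma GDERIV_unique:
  assumes "GDERIV f x :> D" "GDERIV f x :> E"
  shows "D = E"
  using has_derivative_unique[OF assms[unfolded gderiv_def]]
  by (metis inner_commute vector_eq_rdot)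

theorem mainTheorem1:
  fixes \<sigma> :: "(int \<times> int) set" and c :: "int \<times> int \<Rightarrow> real" and d :: nat
    and \<omega> :: "int \<times> int \<Rightarrow> real" and p :: "int \<times> int \<Rightarrow> real ^ 3"
  assumes "finite \<sigma>"
    and "aff_dim (lattice_hull \<sigma>) = 2"
    and "\<And>s. s \<in> \<sigma> \<Longrightarrow> c s > 0"
    and "d \<ge> 1"
    and "\<And>g. g \<in> minkowski_power \<sigma> d \<Longrightarrow> \<omega> g \<ge> 0"
  shows "quasi_harmonic \<sigma> c d (mass_point \<omega> p) \<longleftrightarrow>
    (\<forall>l\<in>inner_points \<sigma> d.
      integral (lattice_hull (minkowski_power \<sigma> d)) (\<lambda>x. \<Sum>g\<in>minkowski_power \<sigma> d.
        (((xi partial_u \<sigma> c d l x + (real d - 1) * eta partial_u \<sigma> c d l x)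
            + (xi partial_v \<sigma> c d l x + (real d - 1) * eta partial_v \<sigma> c d l x))
         * ((xi partial_u \<sigma> c d g x + (real d - 1) * eta partial_u \<sigma> c d g x)
            + (xi partial_v \<sigma> c d g x + (real d - 1) * eta partial_v \<sigma> c d g x)))
        *\<^sub>R mass_point \<omega> p g) = 0)"
proof -
  let ?G = "minkowski_power \<sigma> d"
  let ?K = "lattice_hull ?G"
  let ?M = "mass_point \<omega> p"
  define h where "h g x =
    (xi partial_u \<sigma> c d g x + (real d - 1) * eta partial_u \<sigma> c d g x)
    + (xi partial_v \<sigma> c d g x + (real d - 1) * eta partial_v \<sigma> c d g x)" for g x
  have fin: "finite ?G"
    using assms(1) by (rule finite_minkowski_power)
  have K: "compact ?K"
    unfolding lattice_hull_def using fin by (simp add: finite_imp_compact_convex_hull)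
  have "real_polynomial_function (h g)" for g
    unfolding h_def using assms(1)
    by (intro real_polynomial_function.intros(2-4) real_polynomial_function_xi real_polynomial_function_eta
        real_polynomial_function_partial_u real_polynomial_function_partial_v)
  then have h: "continuous_on ?K (h g)" for g
    by (simp add: continuous_on_polymonial_function real_polynomial_function_eq)
  \<comment> \<open>One factor \<open>d\<close> comes out of both sums and leaves
    \<open>d - 1\<close> at \<open>eta\<close>. This is real subtraction, so the \<open>eta\<close>
    terms vanish for \<open>d = 1\<close>.\<close>
  have laplacian: "patch_second partial_u \<sigma> c d M x + patch_second partial_v \<sigma> c d M x
      = real d *\<^sub>R (\<Sum>g\<in>?G. h g x *\<^sub>R M g)" for M x
    unfolding patch_second_def h_def
    by (simp add: scaleR_sum_right sum.distrib[symmetric] algebra_simps)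
  have functional: "quasi_harmonic_functional \<sigma> c d M = (real d)\<^sup>2 *
      integral ?K (\<lambda>x. (\<Sum>g\<in>?G. h g x *\<^sub>R M g) \<bullet> (\<Sum>g\<in>?G. h g x *\<^sub>R M g))" for M
    unfolding quasi_harmonic_functional_def laplacian
    by (simp add: power2_eq_square mult.assoc)
  have grad: "GDERIV (\<lambda>m. quasi_harmonic_functional \<sigma> c d (?M(l := m))) (?M l)
      :> (real d)\<^sup>2 *\<^sub>R (2 *\<^sub>R integral ?K (\<lambda>x. \<Sum>g\<in>?G. (h l x * h g x) *\<^sub>R ?M g))"
    if "l \<in> inner_points \<sigma> d" for l
  proof -
    have "l \<in> ?G"
      using that by (simp add: inner_points_def)
    from GDERIV_integral_norm_square[OF fin this K h, where M = ?M] show ?thesis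
      unfolding functional gderiv_def inner_scaleR_right
      by (rule has_derivative_mult_right)
  qed
  \<comment> \<open>Uniqueness of the gradient gives one direction, where the factor
    \<open>2 * d^2\<close> cancels because \<open>d \<ge> 1\<close>; the other is
    \<open>grad\<close> itself.\<close>
  have "GDERIV (\<lambda>m. quasi_harmonic_functional \<sigma> c d (?M(l := m))) (?M l) :> 0 \<longleftrightarrow>
      integral ?K (\<lambda>x. \<Sum>g\<in>?G. (h l x * h g x) *\<^sub>R ?M g) = 0"
    if "l \<in> inner_points \<sigma> d" for l
    using grad[OF that] GDERIV_unique[OF grad[OF that]] \<open>d \<ge> 1\<close> by fastforce
  then show ?thesis
    unfolding quasi_harmonic_def h_def by blast
qed

end
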